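(* Let $(X,\tau)$ be a strong $R$-space (in particular, this applies if $(X,\tau)$ is a coherent well-filtered space, or a $T_2$-space). Then $\tau\subseteq\tau^{dd}$.
   Context: For a $T_0$-space $X$: a subset is saturated if it equals the intersection of all open sets containing it; $Q(X)$ is the set of all nonempty compact saturated subsets of $X$ (compactness is the open-cover property). A $T_0$-space $X$ is a strong $R$-space if for every nonempty family $\{K_i: i\in I\}\subseteq Q(X)$ and every open $U\subseteq X$, $\bigcap_{i\in I}K_i\subseteq U$ implies $\bigcap_{i\in J}K_i\subseteq U$ for some nonempty finite $J\subseteq I$. A $T_0$-space $X$ is well-filtered if for every $\mathcal K\subseteq Q(X)$ that is filtered (nonempty and any two members of $\mathcal K$ contain a common member of $\mathcal K$) and every open $U$, $\bigcap\mathcal K\subseteq U$ implies $K\subseteq U$ for some $K\in\mathcal K$. $X$ is coherent if the intersection of any two compact saturated sets is compact. The (de Groot) dual $\tau^{d}$ of a $T_0$-topology $\tau$ is the topology on the same set having all compact saturated sets of $(X,\tau)$ as a basis for its closed sets (so its closed sets are exactly the arbitrary intersections of compact saturated sets of $(X,\tau)$, the empty intersection being the whole set); $\tau^{dd}=(\tau^{d})^{d}$. *)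

theory Defs
  imports "HOL-Analysis.Analysis"
begin

(* The conjunct S <= topspace X is needed because the intersection over the empty family is UNIV. *)
definition saturatedin :: "'a topology \<Rightarrow> 'a set \<Rightarrow> bool" where
  "saturatedin X S \<longleftrightarrow> S \<subseteq> topspace X \<and> S = \<Inter>{U. openin X U \<and> S \<subseteq> U}"

definition compact_saturatedin :: "'a topology \<Rightarrow> 'a set \<Rightarrow> bool" where
  "compact_saturatedin X K \<longleftrightarrow> compactin X K \<and> saturatedin X K"

definition nonempty_compact_saturated_sets :: "'a topology \<Rightarrow> 'a set set" where
  "nonempty_compact_saturated_sets X = {K. K \<noteq> {} \<and> compact_saturatedin X K}"

(* Families are given as sets of sets: the intersection of an indexed family depends only on its
   range, and finite subsets of the range correspond to finite subsets of the index set. *)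
definition strong_R_space :: "'a topology \<Rightarrow> bool" where
  "strong_R_space X \<longleftrightarrow> t0_space X \<and>
     (\<forall>\<K> U. \<K> \<subseteq> nonempty_compact_saturated_sets X \<and> \<K> \<noteq> {} \<and> openin X U \<and> \<Inter>\<K> \<subseteq> U \<longrightarrow>
        (\<exists>\<J>. finite \<J> \<and> \<J> \<noteq> {} \<and> \<J> \<subseteq> \<K> \<and> \<Inter>\<J> \<subseteq> U))"

(* Filtered for the reverse inclusion order. *)
definition filtered_family :: "'a set set \<Rightarrow> bool" where
  "filtered_family \<K> \<longleftrightarrow> \<K> \<noteq> {} \<and> (\<forall>A\<in>\<K>. \<forall>B\<in>\<K>. \<exists>C\<in>\<K>. C \<subseteq> A \<and> C \<subseteq> B)"

definition well_filtered_space :: "'a topology \<Rightarrow> bool" where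
  "well_filtered_space X \<longleftrightarrow> t0_space X \<and>
     (\<forall>\<K> U. \<K> \<subseteq> nonempty_compact_saturated_sets X \<and> filtered_family \<K> \<and> openin X U \<and> \<Inter>\<K> \<subseteq> U \<longrightarrow>
        (\<exists>K\<in>\<K>. K \<subseteq> U))"

definition coherent_space :: "'a topology \<Rightarrow> bool" where
  "coherent_space X \<longleftrightarrow>
     (\<forall>K L. compact_saturatedin X K \<and> compact_saturatedin X L \<longrightarrow> compactin X (K \<inter> L))"

(* The closed sets are the intersections of compact saturated sets; intersecting with topspace X
   makes the empty intersection the whole space. *)
definition de_groot_dual :: "'a topology \<Rightarrow> 'a topology" where
  "de_groot_dual X = topology (\<lambda>U. U \<subseteq> topspace X \<and>
     (\<exists>\<K>. (\<forall>K\<in>\<K>. compact_saturatedin X K) \<and> topspace X - U = topspace X \<inter> \<Inter>\<K>))"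

lemma saturatedin_iff:
  "saturatedin X S \<longleftrightarrow>
     S \<subseteq> topspace X \<and> (\<forall>x\<in>topspace X - S. \<exists>U. openin X U \<and> S \<subseteq> U \<and> x \<notin> U)"
proof
  assume S: "saturatedin X S"
  then have "x \<in> \<Inter>{U. openin X U \<and> S \<subseteq> U} \<Longrightarrow> x \<in> S" for x
    unfolding saturatedin_def by simp
  with S show "S \<subseteq> topspace X \<and> (\<forall>x\<in>topspace X - S. \<exists>U. openin X U \<and> S \<subseteq> U \<and> x \<notin> U)"
    unfolding saturatedin_def by blast
next
  assume R: "S \<subseteq> topspace X \<and> (\<forall>x\<in>topspace X - S. \<exists>U. openin X U \<and> S \<subseteq> U \<and> x \<notin> U)"
  have "\<Inter>{U. openin X U \<and> S \<subseteq> U} \<subseteq> S"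
  proof
    fix x assume x: "x \<in> \<Inter>{U. openin X U \<and> S \<subseteq> U}"
    with R have "x \<in> topspace X" by blast
    with R x show "x \<in> S" by blast
  qed
  with R show "saturatedin X S"
    unfolding saturatedin_def by blast
qed

lemma compact_saturatedin_empty: "compact_saturatedin X {}"
  unfolding compact_saturatedin_def saturatedin_iff by auto

lemma compact_saturatedin_Un:
  assumes "compact_saturatedin X K" "compact_saturatedin X L"
  shows "compact_saturatedin X (K \<union> L)"
proof -
  have "\<exists>U. openin X U \<and> K \<union> L \<subseteq> U \<and> x \<notin> U" if "x \<in> topspace X - (K \<union> L)" for x
  proof -
    have "x \<in> topspace X - K" "x \<in> topspace X - L"
      using that by auto
    with assms obtain U V where "openin X U" "K \<subseteq> U" "x \<notin> U" "openin X V" "L \<subseteq> V" "x \<notin> V"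
      unfolding compact_saturatedin_def saturatedin_iff by meson
    then show ?thesis
      by (intro exI[of _ "U \<union> V"]) auto
  qed
  with assms show ?thesis
    unfolding compact_saturatedin_def saturatedin_iff by (auto simp: compactin_Un)
qed

lemma openin_de_groot_dual:
  "openin (de_groot_dual X) U \<longleftrightarrow> U \<subseteq> topspace X \<and>
     (\<exists>\<K>. (\<forall>K\<in>\<K>. compact_saturatedin X K) \<and> topspace X - U = topspace X \<inter> \<Inter>\<K>)"
proof -
  define P where "P = (\<lambda>U. U \<subseteq> topspace X \<and>
     (\<exists>\<K>. (\<forall>K\<in>\<K>. compact_saturatedin X K) \<and> topspace X - U = topspace X \<inter> \<Inter>\<K>))"
  have "istopology P"
    unfolding istopology_def
  proof (intro conjI allI impI)
    fix S T assume "P S" "P T"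
    then obtain \<K> \<L> where
      K: "S \<subseteq> topspace X" "\<forall>K\<in>\<K>. compact_saturatedin X K" "topspace X - S = topspace X \<inter> \<Inter>\<K>" and
      L: "T \<subseteq> topspace X" "\<forall>K\<in>\<L>. compact_saturatedin X K" "topspace X - T = topspace X \<inter> \<Inter>\<L>"
      unfolding P_def by blast
    have "topspace X - (S \<inter> T) = (topspace X \<inter> \<Inter>\<K>) \<union> (topspace X \<inter> \<Inter>\<L>)"
      unfolding K(3)[symmetric] L(3)[symmetric] by blast
    also have "\<dots> = topspace X \<inter> \<Inter>{A \<union> B |A B. A \<in> \<K> \<and> B \<in> \<L>}"
      by blast
    finally have "topspace X - (S \<inter> T) = topspace X \<inter> \<Inter>{A \<union> B |A B. A \<in> \<K> \<and> B \<in> \<L>}" .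
    moreover have "\<forall>K\<in>{A \<union> B |A B. A \<in> \<K> \<and> B \<in> \<L>}. compact_saturatedin X K"
      using K(2) L(2) compact_saturatedin_Un by blast
    ultimately show "P (S \<inter> T)"
      unfolding P_def using K(1) by blast
  next
    fix \<U> assume "\<forall>U\<in>\<U>. P U"
    then obtain f where f: "\<And>U. U \<in> \<U> \<Longrightarrow> U \<subseteq> topspace X"
      "\<And>U K. U \<in> \<U> \<Longrightarrow> K \<in> f U \<Longrightarrow> compact_saturatedin X K"
      "\<And>U. U \<in> \<U> \<Longrightarrow> topspace X - U = topspace X \<inter> \<Inter>(f U)"
      unfolding P_def by metis
    have "topspace X - \<Union>\<U> = topspace X \<inter> (\<Inter>U\<in>\<U>. topspace X - U)"
      by blast
    also have "\<dots> = topspace X \<inter> (\<Inter>U\<in>\<U>. topspace X \<inter> \<Inter>(f U))"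
      using f(3) by simp
    also have "\<dots> = topspace X \<inter> \<Inter>(\<Union>U\<in>\<U>. f U)"
      by blast
    finally have "topspace X - \<Union>\<U> = topspace X \<inter> \<Inter>(\<Union>U\<in>\<U>. f U)" .
    moreover have "\<forall>K\<in>(\<Union>U\<in>\<U>. f U). compact_saturatedin X K"
      using f(2) by blast
    ultimately show "P (\<Union>\<U>)"
      unfolding P_def using f(1) by blast
  qed
  then have "openin (topology P) = P"
    by (rule topology_inverse')
  then have "openin (topology P) U = P U"
    by simp
  then show ?thesis
    unfolding de_groot_dual_def P_def .
qed

lemma topspace_de_groot_dual [simp]: "topspace (de_groot_dual X) = topspace X"
proof
  show "topspace (de_groot_dual X) \<subseteq> topspace X"
    using openin_de_groot_dual[of X "topspace (de_groot_dual X)"] by simp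
  have "openin (de_groot_dual X) (topspace X)"
    unfolding openin_de_groot_dual
    by (intro conjI subset_refl exI[of _ "{{}}"]) (simp_all add: compact_saturatedin_empty)
  then show "topspace X \<subseteq> topspace (de_groot_dual X)"
    by (rule openin_subset)
qed

lemma closedin_de_groot_dual:
  "closedin (de_groot_dual X) C \<longleftrightarrow>
     (\<exists>\<K>. (\<forall>K\<in>\<K>. compact_saturatedin X K) \<and> C = topspace X \<inter> \<Inter>\<K>)"
proof (cases "C \<subseteq> topspace X")
  case True
  then have "topspace X - (topspace X - C) = C"
    by blast
  with True show ?thesis
    unfolding closedin_def openin_de_groot_dual topspace_de_groot_dual by simp
next
  case False
  then have "C \<noteq> topspace X \<inter> \<Inter>\<K>" for \<K>
    using Int_lower1 by metis
  then show ?thesis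
    unfolding closedin_def topspace_de_groot_dual using False by simp
qed

lemma t0_space_de_groot_dual:
  assumes "t0_space X"
  shows "t0_space (de_groot_dual X)"
proof -
  define up where "up = (\<lambda>x. \<Inter>{U. openin X U \<and> x \<in> U})"
  have up: "compact_saturatedin X (up x)" "x \<in> up x" if x: "x \<in> topspace X" for x
  proof -
    show xx: "x \<in> up x"
      unfolding up_def by blast
    have sub: "up x \<subseteq> U" if "openin X U" "x \<in> U" for U
      unfolding up_def using that by blast
    have top: "up x \<subseteq> topspace X"
      using sub x by blast
    have "\<exists>\<F>. finite \<F> \<and> \<F> \<subseteq> \<U> \<and> up x \<subseteq> \<Union>\<F>"
      if U: "\<forall>U\<in>\<U>. openin X U" "up x \<subseteq> \<Union>\<U>" for \<U>
    proof -
      obtain U where "U \<in> \<U>" "x \<in> U"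
        using xx U(2) by blast
      with U(1) sub show ?thesis
        by (intro exI[of _ "{U}"]) auto
    qed
    then have "compactin X (up x)"
      unfolding compactin_def using top by blast
    moreover have "saturatedin X (up x)"
      unfolding saturatedin_iff
    proof (intro conjI top ballI)
      fix y assume "y \<in> topspace X - up x"
      then obtain U where "openin X U" "x \<in> U" "y \<notin> U"
        unfolding up_def by blast
      with sub show "\<exists>U. openin X U \<and> up x \<subseteq> U \<and> y \<notin> U"
        by blast
    qed
    ultimately show "compact_saturatedin X (up x)"
      unfolding compact_saturatedin_def by blast
  qed
  have op: "openin (de_groot_dual X) (topspace X - up x)" if "x \<in> topspace X" for x
    unfolding openin_de_groot_dual
    by (intro conjI exI[of _ "{up x}"]) (use up(1)[OF that] in auto)
  show ?thesis
    unfolding t0_space_def topspace_de_groot_dual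
  proof (intro ballI impI)
    fix x y assume x: "x \<in> topspace X" and y: "y \<in> topspace X" and "x \<noteq> y"
    with assms obtain U where U: "openin X U" "x \<notin> U \<longleftrightarrow> y \<in> U"
      unfolding t0_space_def by blast
    show "\<exists>U. openin (de_groot_dual X) U \<and> (x \<notin> U \<longleftrightarrow> y \<in> U)"
    proof (cases "x \<in> U")
      case True
      with U have "y \<notin> up x" unfolding up_def by blast
      with op[OF x] up(2)[OF x] y show ?thesis by blast
    next
      case False
      with U have "x \<notin> up y" unfolding up_def by blast
      with op[OF y] up(2)[OF y] x show ?thesis by blast
    qed
  qed
qed

end

theory Submission
  imports Defs
begin

text \<open>In a strong R-space every closed set \<open>A\<close> is itself compact saturated for the dual topology.
  It is saturated because the complement of \<open>A\<close> contains, with each point, the saturation of that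
  point, which is compact.  It is compact because a dual-open cover may be refined to one by
  complements of compact saturated sets \<open>K\<close>; being a cover of \<open>A\<close> means that the intersection of
  these \<open>K\<close> lies in the open complement of \<open>A\<close>, and the strong R-property gives a finite subcover.\<close>

text \<open>The strong R-property speaks of nonempty compact saturated sets, whereas families coming
  from the dual topology may contain the empty set. In that case \<open>{{}}\<close> is already a
  suitable finite subfamily.\<close>

lemma strong_R_spaceD:
  assumes "strong_R_space X" "openin X U" "\<K> \<noteq> {}" "\<Inter>\<K> \<subseteq> U"
    and K: "\<And>K. K \<in> \<K> \<Longrightarrow> compact_saturatedin X K"
  shows "\<exists>\<J>. finite \<J> \<and> \<J> \<noteq> {} \<and> \<J> \<subseteq> \<K> \<and> \<Inter>\<J> \<subseteq> U"
proof (cases "{} \<in> \<K>")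
  case True
  then show ?thesis
    by (intro exI[of _ "{{}}"]) auto
next
  case False
  then have "\<K> \<subseteq> nonempty_compact_saturated_sets X"
    using K unfolding nonempty_compact_saturated_sets_def by auto
  with assms show ?thesis
    unfolding strong_R_space_def by blast
qed

text \<open>Every open set containing \<open>x\<close> contains all of \<open>?S\<close>, so the one
  member of an open cover that contains \<open>x\<close> is a subcover.\<close>

lemma compact_saturatedin_saturation_point:
  assumes x: "x \<in> topspace X"
  shows "compact_saturatedin X (\<Inter>{U. openin X U \<and> x \<in> U})" (is "compact_saturatedin X ?S")
  unfolding compact_saturatedin_def
proof
  have sub: "?S \<subseteq> U" if "openin X U" "x \<in> U" for U
    using that by blast
  then have top: "?S \<subseteq> topspace X"
    using x by blast
  show "compactin X ?S"
    unfolding compactin_def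
  proof (intro conjI top allI impI)
    fix \<U> assume \<U>: "Ball \<U> (openin X) \<and> ?S \<subseteq> \<Union>\<U>"
    then obtain U where "U \<in> \<U>" "x \<in> U"
      by blast
    with \<U> sub show "\<exists>\<F>. finite \<F> \<and> \<F> \<subseteq> \<U> \<and> ?S \<subseteq> \<Union>\<F>"
      by (intro exI[of _ "{U}"]) auto
  qed
  show "saturatedin X ?S"
    unfolding saturatedin_iff using top sub by blast
qed

lemma saturatedin_de_groot_dual_closedin:
  assumes A: "closedin X A"
  shows "saturatedin (de_groot_dual X) A"
  unfolding saturatedin_iff topspace_de_groot_dual
proof (intro conjI ballI)
  show "A \<subseteq> topspace X"
    using A by (rule closedin_subset)
  fix x assume x: "x \<in> topspace X - A"
  let ?S = "\<Inter>{U. openin X U \<and> x \<in> U}"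
  have "openin X (topspace X - A)"
    using A by (rule openin_diff[OF openin_topspace])
  \<comment> \<open>The open complement of \<open>A\<close> contains \<open>x\<close>, so it is one
    of the sets intersected in \<open>?S\<close>.\<close>
  then have "A \<subseteq> topspace X - ?S"
    using x closedin_subset[OF A] by blast
  moreover have "openin (de_groot_dual X) (topspace X - ?S)"
    unfolding openin_de_groot_dual
    using compact_saturatedin_saturation_point[of x X] x
    by (intro conjI exI[of _ "{?S}"]) auto
  ultimately show "\<exists>U. openin (de_groot_dual X) U \<and> A \<subseteq> U \<and> x \<notin> U"
    by blast
qed

lemma compactin_de_groot_dual_closedin:
  assumes R: "strong_R_space X" and A: "closedin X A"
  shows "compactin (de_groot_dual X) A"
  unfolding compactin_def topspace_de_groot_dual
proof (intro conjI allI impI)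
  show AX: "A \<subseteq> topspace X"
    using A by (rule closedin_subset)
  fix \<V> assume \<V>: "Ball \<V> (openin (de_groot_dual X)) \<and> A \<subseteq> \<Union>\<V>"
  \<comment> \<open>The complements of these \<open>K\<close> refine the cover; keeping the witness
    \<open>V\<close> allows a return from a finite subfamily to members of
    \<open>\<V>\<close>.\<close>
  define \<K> where "\<K> = {K. compact_saturatedin X K \<and> (\<exists>V\<in>\<V>. topspace X - K \<subseteq> V)}"
  have avoid: "\<exists>K\<in>\<K>. x \<notin> K" if x: "x \<in> A" for x
  proof -
    obtain V where V: "V \<in> \<V>" "x \<in> V" "openin (de_groot_dual X) V"
      using \<V> x by blast
    then obtain \<L> where \<L>: "\<forall>K\<in>\<L>. compact_saturatedin X K"
      "topspace X - V = topspace X \<inter> \<Inter>\<L>"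
      unfolding openin_de_groot_dual by blast
    \<comment> \<open>A dual-open \<open>V\<close> is the union of the complements of the members of
      \<open>\<L>\<close>, so one such complement contains \<open>x\<close>.\<close>
    then obtain K where "K \<in> \<L>" "x \<notin> K"
      using V(2) x AX by blast
    with \<L> V(1) show ?thesis
      unfolding \<K>_def by blast
  qed
  show "\<exists>\<F>. finite \<F> \<and> \<F> \<subseteq> \<V> \<and> A \<subseteq> \<Union>\<F>"
  proof (cases "A = {}")
    \<comment> \<open>The strong R-property applies only to a nonempty family, and a point of
      \<open>A\<close> supplies a member of \<open>\<K>\<close>. For empty \<open>A\<close> the
      empty subcover works.\<close>
    case False
    then have ne: "\<K> \<noteq> {}"
      using avoid by blast
    have comp: "compact_saturatedin X K" if "K \<in> \<K>" for K
      using that unfolding \<K>_def by simp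
    then have "K \<subseteq> topspace X" if "K \<in> \<K>" for K
      using that unfolding compact_saturatedin_def saturatedin_def by blast
    then have "\<Inter>\<K> \<subseteq> topspace X - A"
      using ne avoid by blast
    moreover have "openin X (topspace X - A)"
      using A by (rule openin_diff[OF openin_topspace])
    ultimately have "\<exists>\<J>. finite \<J> \<and> \<J> \<noteq> {} \<and> \<J> \<subseteq> \<K> \<and> \<Inter>\<J> \<subseteq> topspace X - A"
      using R ne comp by (intro strong_R_spaceD)
    then obtain \<J> where \<J>: "finite \<J>" "\<J> \<subseteq> \<K>" "\<Inter>\<J> \<subseteq> topspace X - A"
      by blast
    then have "\<forall>K\<in>\<J>. \<exists>V\<in>\<V>. topspace X - K \<subseteq> V"
      unfolding \<K>_def by blast
    then obtain f where f: "\<And>K. K \<in> \<J> \<Longrightarrow> f K \<in> \<V>" "\<And>K. K \<in> \<J> \<Longrightarrow> topspace X - K \<subseteq> f K"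
      by metis
    have "A \<subseteq> \<Union>(f ` \<J>)"
      using \<J>(3) f(2) AX by blast
    with \<J>(1) f(1) show ?thesis
      by (intro exI[of _ "f ` \<J>"]) auto
  qed auto
qed

lemma openin_de_groot_dual_dual:
  assumes "strong_R_space X" "openin X U"
  shows "openin (de_groot_dual (de_groot_dual X)) U"
proof -
  have "closedin X (topspace X - U)"
    using assms(2) by (rule closedin_diff[OF closedin_topspace])
  then have "compact_saturatedin (de_groot_dual X) (topspace X - U)"
    unfolding compact_saturatedin_def
    using compactin_de_groot_dual_closedin[OF assms(1)] saturatedin_de_groot_dual_closedin by blast
  then show ?thesis
    unfolding openin_de_groot_dual[of "de_groot_dual X"] topspace_de_groot_dual
    using openin_subset[OF assms(2)] by (intro conjI exI[of _ "{topspace X - U}"]) auto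
qed

lemma saturatedin_Int:
  assumes "saturatedin X S" "saturatedin X T"
  shows "saturatedin X (S \<inter> T)"
  unfolding saturatedin_iff
proof (intro conjI ballI)
  show "S \<inter> T \<subseteq> topspace X"
    using assms(1) unfolding saturatedin_iff by blast
  fix x assume "x \<in> topspace X - S \<inter> T"
  then consider "x \<in> topspace X - S" | "x \<in> topspace X - T"
    by blast
  then show "\<exists>U. openin X U \<and> S \<inter> T \<subseteq> U \<and> x \<notin> U"
    using assms unfolding saturatedin_iff by cases (meson Int_lower1 Int_lower2 subset_trans)+
qed

text \<open>Induction on the family: coherence gives compactness of each binary intersection, and
  saturation is inherited separately.\<close>

lemma compact_saturatedin_Inter:
  assumes coh: "coherent_space X"
    and "finite \<J>" "\<J> \<noteq> {}" "\<And>K. K \<in> \<J> \<Longrightarrow> compact_saturatedin X K"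
  shows "compact_saturatedin X (\<Inter>\<J>)"
  using assms(2-)
proof (induction \<J> rule: finite_ne_induct)
  case (insert K \<J>)
  then have "compact_saturatedin X K" "compact_saturatedin X (\<Inter>\<J>)"
    by auto
  with coh have "compact_saturatedin X (K \<inter> \<Inter>\<J>)"
    unfolding coherent_space_def compact_saturatedin_def by (blast intro: saturatedin_Int)
  then show ?case
    by simp
qed auto

text \<open>The finite intersections of members of \<open>\<K>\<close> form a filtered family with
  the same intersection as \<open>\<K>\<close>. Coherence keeps them compact saturated, and
  well-filteredness puts one of them inside \<open>U\<close>.\<close>

lemma strong_R_space_coherent_well_filtered:
  assumes coh: "coherent_space X" and wf: "well_filtered_space X"
  shows "strong_R_space X"
  unfolding strong_R_space_def
proof (intro conjI allI impI)
  show "t0_space X"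
    using wf unfolding well_filtered_space_def by blast
  fix \<K> U
  assume *: "\<K> \<subseteq> nonempty_compact_saturated_sets X \<and> \<K> \<noteq> {} \<and> openin X U \<and> \<Inter>\<K> \<subseteq> U"
  define \<F> where "\<F> = {\<Inter>\<J> |\<J>. finite \<J> \<and> \<J> \<noteq> {} \<and> \<J> \<subseteq> \<K>}"
  have "\<exists>D\<in>\<F>. D \<subseteq> U"
  \<comment> \<open>If some finite intersection is empty, it lies in \<open>U\<close> at once;
    otherwise \<open>\<F>\<close> consists of nonempty sets, as well-filteredness demands.\<close>
  proof (cases "{} \<in> \<F>")
    case False
    have "compact_saturatedin X (\<Inter>\<J>)" if "finite \<J>" "\<J> \<noteq> {}" "\<J> \<subseteq> \<K>" for \<J>
      using compact_saturatedin_Inter[OF coh that(1,2)] that(3) *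
      unfolding nonempty_compact_saturated_sets_def by blast
    with False have "\<F> \<subseteq> nonempty_compact_saturated_sets X"
      unfolding nonempty_compact_saturated_sets_def \<F>_def by auto
    moreover have K\<F>: "K \<in> \<F>" if "K \<in> \<K>" for K
      unfolding \<F>_def using that by (intro CollectI exI[of _ "{K}"]) auto
    moreover have "filtered_family \<F>"
      unfolding filtered_family_def
    proof (intro conjI ballI)
      show "\<F> \<noteq> {}"
        using * K\<F> by blast
      fix C D assume "C \<in> \<F>" "D \<in> \<F>"
      then obtain \<I> \<J> where "finite \<I>" "\<I> \<noteq> {}" "\<I> \<subseteq> \<K>" "C = \<Inter>\<I>"
        "finite \<J>" "\<J> \<noteq> {}" "\<J> \<subseteq> \<K>" "D = \<Inter>\<J>"
        unfolding \<F>_def by blast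
      then have "C \<inter> D \<in> \<F>"
        unfolding \<F>_def by (intro CollectI exI[of _ "\<I> \<union> \<J>"]) auto
      then show "\<exists>E\<in>\<F>. E \<subseteq> C \<and> E \<subseteq> D"
        by blast
    qed
    moreover have "\<Inter>\<F> \<subseteq> U"
      using * K\<F> by blast
    ultimately show ?thesis
      using wf * unfolding well_filtered_space_def by blast
  qed auto
  then show "\<exists>\<J>. finite \<J> \<and> \<J> \<noteq> {} \<and> \<J> \<subseteq> \<K> \<and> \<Inter>\<J> \<subseteq> U"
    unfolding \<F>_def by blast
qed

text \<open>Compact sets are closed here, so \<open>U\<close> and the complements of the members of
  \<open>\<K>\<close> form an open cover of any single \<open>L\<close> in \<open>\<K>\<close>; a
  finite subcover names the members needed.\<close>

lemma strong_R_space_Hausdorff: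
  assumes H: "Hausdorff_space X"
  shows "strong_R_space X"
  unfolding strong_R_space_def
proof (intro conjI allI impI)
  show "t0_space X"
    using H by (intro t1_imp_t0_space Hausdorff_imp_t1_space)
  fix \<K> U
  assume *: "\<K> \<subseteq> nonempty_compact_saturated_sets X \<and> \<K> \<noteq> {} \<and> openin X U \<and> \<Inter>\<K> \<subseteq> U"
  have comp: "compactin X K" if "K \<in> \<K>" for K
    using * that unfolding nonempty_compact_saturated_sets_def compact_saturatedin_def by blast
  obtain L where L: "L \<in> \<K>"
    using * by blast
  define \<U> where "\<U> = insert U ((\<lambda>K. topspace X - K) ` \<K>)"
  have "\<forall>V\<in>\<U>. openin X V"
    using * comp compactin_imp_closedin[OF H] unfolding \<U>_def by blast
  moreover have "L \<subseteq> \<Union>\<U>"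
    using * compactin_subset_topspace[OF comp[OF L]] unfolding \<U>_def by blast
  ultimately obtain \<F> where \<F>: "finite \<F>" "\<F> \<subseteq> \<U>" "L \<subseteq> \<Union>\<F>"
    using comp[OF L] unfolding compactin_def by meson
  then have "finite (\<F> - {U})" "\<F> - {U} \<subseteq> (\<lambda>K. topspace X - K) ` \<K>"
    unfolding \<U>_def by auto
  then obtain \<J> where \<J>: "finite \<J>" "\<J> \<subseteq> \<K>" "\<F> - {U} = (\<lambda>K. topspace X - K) ` \<J>"
    by (meson finite_subset_image)
  \<comment> \<open>A point of \<open>L\<close> lying in every member of \<open>\<J>\<close> avoids
    all of \<open>\<F> - {U}\<close>, so only \<open>U\<close> can cover it.\<close>
  have "\<Inter>(insert L \<J>) \<subseteq> U"
    using \<F>(3) \<J>(3) by blast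
  with L \<J> show "\<exists>\<J>. finite \<J> \<and> \<J> \<noteq> {} \<and> \<J> \<subseteq> \<K> \<and> \<Inter>\<J> \<subseteq> U"
    by (intro exI[of _ "insert L \<J>"]) auto
qed

theorem corollary4p10:
  fixes X :: "'a topology"
  shows "(strong_R_space X \<longrightarrow>
            {U. openin X U} \<subseteq> {U. openin (de_groot_dual (de_groot_dual X)) U}) \<and>
         (coherent_space X \<and> well_filtered_space X \<longrightarrow> strong_R_space X) \<and>
         (Hausdorff_space X \<longrightarrow> strong_R_space X)"
  using openin_de_groot_dual_dual[of X] strong_R_space_coherent_well_filtered[of X]
    strong_R_space_Hausdorff[of X] by blast

end
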